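(* Let $3\le\ell_1<\dots<\ell_r\le n$ be indices of interior knots of $\Theta$. Every solution $U_2\in\mathbb{R}^{(n-2)\times(n-2)}$ of the equation $AU_2=B$, where $$A=\bigl[N_{4,k}(\theta_{\ell_j})\bigr]_{j=1,\dots,r;\ k=1,\dots,n-2}\in\mathbb{R}^{r\times(n-2)},\qquad B=\bigl[\kappa_{\ell_j}e_{\ell_j-2}^T\bigr]_{j=1,\dots,r}\in\mathbb{R}^{r\times(n-2)},$$ and $$\kappa_\ell=\frac{(\theta_\ell-\theta_{\ell-1})^2(\theta_{\ell+1}-\theta_\ell)^2}{18(\theta_{\ell+1}-\theta_{\ell-1})},$$ defines a kernel $L(x,y)=\Phi_2(y)\,S_L\,\Phi_2(x)^T$ with $S_L=S+D_2^TD_3^T\,U_2\,D_3D_2$, which reproduces all polynomials of degree (at most) $1$ and all truncated powers $(\theta_{\ell_j}-x)_+$ with $1\le j\le r$; that is, $\int_a^b p(y)L(x,y)\,dy=p(x)$ on $[a,b]$ for each of these functions $p$.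
   Context: Let $\Theta=\{\theta_1\le\dots\le\theta_{n+2}\}$ be a knot vector in $[a,b]$ with $\theta_1=\theta_2=a$, $\theta_{n+1}=\theta_{n+2}=b$ and simple interior knots $a<\theta_3<\dots<\theta_n<b$. B-splines of order $s\in\{2,3,4\}$: $N_{s,k}(x)=(\theta_{k+s}-\theta_k)\,[\theta_k,\dots,\theta_{k+s}\mid(\cdot-x)_+^{s-1}]$, $1\le k\le n+2-s$ (divided difference; values at $x=b$ are left limits). $\Phi_2=(N_{2,1},\dots,N_{2,n})$ (row vector). With $h_{j,k}=(\theta_{k+j}-\theta_k)/j$, $D_2$ is the $(n-1)\times n$ matrix with $(D_2)_{i,i}=h_{2,i}^{-1}$, $(D_2)_{i,i+1}=-h_{2,i+1}^{-1}$, and $D_3$ is the $(n-2)\times(n-1)$ matrix with $(D_3)_{i,i}=h_{3,i}^{-1}$, $(D_3)_{i,i+1}=-h_{3,i+1}^{-1}$; all other entries are $0$. $S=(s_{i,j})\in\mathbb{R}^{n\times n}$ is the symmetric tridiagonal matrix with $$s_{j,j}=\frac{2}{\theta_{j+2}-\theta_j}+\frac{2}{(\theta_{j+2}-\theta_j)^2}(\alpha_{j-1}+\alpha_j),\qquad s_{j+1,j}=s_{j,j+1}=-\frac{2(\theta_{j+2}-\theta_{j+1})^2}{(\theta_{j+2}-\theta_j)(\theta_{j+3}-\theta_j)(\theta_{j+3}-\theta_{j+1})},$$ where $\alpha_0=\alpha_n=0$ and $\alpha_j=\frac{(\theta_{j+2}-\theta_{j+1})^2}{\theta_{j+3}-\theta_j}$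 for $1\le j\le n-1$. $e_k$ denotes the $k$-th canonical unit (column) vector in $\mathbb{R}^{n-2}$. *)

theory Defs
  imports
    "HOL-Analysis.Analysis"
    "HOL-Computational_Algebra.Polynomial"
    "Jordan_Normal_Form.Matrix"
begin

no_notation inner (infix "\<bullet>" 70)

text \<open>
  Knots are functions \<open>\<theta> :: nat \<Rightarrow> real\<close> of which only the values at \<open>1, \<dots>, n + 2\<close> matter.
  Strictness on \<open>{2..n+1}\<close> expresses \<open>a < \<theta> 3 < \<dots> < \<theta> n < b\<close>.
\<close>

definition knot_vector :: "nat \<Rightarrow> real \<Rightarrow> real \<Rightarrow> (nat \<Rightarrow> real) \<Rightarrow> bool" where
  "knot_vector n a b \<theta> \<longleftrightarrow>
     2 \<le> n \<and> \<theta> 1 = a \<and> \<theta> 2 = a \<and> \<theta> (n + 1) = b \<and> \<theta> (n + 2) = b \<and>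
     strict_mono_on {2..n+1} \<theta>"

text \<open>
  \<open>divdiff \<theta> f k m\<close> is the divided difference \<open>[\<theta> k, \<dots>, \<theta> (k + m) | f]\<close> for nondecreasing
  \<open>\<theta>\<close>, where coincident knots are resolved by derivatives of \<open>f\<close>.
\<close>

fun divdiff :: "(nat \<Rightarrow> real) \<Rightarrow> (real \<Rightarrow> real) \<Rightarrow> nat \<Rightarrow> nat \<Rightarrow> real" where
  "divdiff \<theta> f k 0 = f (\<theta> k)"
| "divdiff \<theta> f k (Suc m) =
     (if \<theta> (k + Suc m) = \<theta> k then (deriv ^^ Suc m) f (\<theta> k) / fact (Suc m)
      else (divdiff \<theta> f (Suc k) m - divdiff \<theta> f k m) / (\<theta> (k + Suc m) - \<theta> k))"

definition trunc_pow :: "nat \<Rightarrow> real \<Rightarrow> real \<Rightarrow> real" where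
  "trunc_pow p x t = (max 0 (t - x)) ^ p"

definition bspline_raw :: "(nat \<Rightarrow> real) \<Rightarrow> nat \<Rightarrow> nat \<Rightarrow> real \<Rightarrow> real" where
  "bspline_raw \<theta> s k x = (\<theta> (k + s) - \<theta> k) * divdiff \<theta> (trunc_pow (s - 1) x) k s"

text \<open>
  The truncated power \<open>t \<mapsto> max 0 (t - x)\<close> has no derivative at \<open>t = x\<close>, so for order 2 the
  divided difference over a double end knot is meaningless exactly when \<open>x\<close> is that end point.
  The values there are the one-sided limits from within \<open>[a, b]\<close>; for orders 3 and 4
  the raw function is continuous and the limits are its values.
\<close>

definition bspline :: "real \<Rightarrow> real \<Rightarrow> (nat \<Rightarrow> real) \<Rightarrow> nat \<Rightarrow> nat \<Rightarrow> real \<Rightarrow> real" where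
  "bspline a b \<theta> s k x =
     (if x = a then Lim (at_right a) (bspline_raw \<theta> s k)
      else if x = b then Lim (at_left b) (bspline_raw \<theta> s k)
      else bspline_raw \<theta> s k x)"

definition Phi2 :: "nat \<Rightarrow> real \<Rightarrow> real \<Rightarrow> (nat \<Rightarrow> real) \<Rightarrow> real \<Rightarrow> real vec" where
  "Phi2 n a b \<theta> x = Matrix.vec n (\<lambda>i. bspline a b \<theta> 2 (i + 1) x)"

text \<open>Matrix entries are given by formulas in indices starting at 1; the library counts from 0.\<close>

definition mat1 :: "nat \<Rightarrow> nat \<Rightarrow> (nat \<Rightarrow> nat \<Rightarrow> real) \<Rightarrow> real mat" where
  "mat1 nr nc f = Matrix.mat nr nc (\<lambda>(i, j). f (i + 1) (j + 1))"

definition hh :: "(nat \<Rightarrow> real) \<Rightarrow> nat \<Rightarrow> nat \<Rightarrow> real" where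
  "hh \<theta> j k = (\<theta> (k + j) - \<theta> k) / real j"

definition D2 :: "nat \<Rightarrow> (nat \<Rightarrow> real) \<Rightarrow> real mat" where
  "D2 n \<theta> = mat1 (n - 1) n (\<lambda>i j.
     if j = i then inverse (hh \<theta> 2 i)
     else if j = i + 1 then - inverse (hh \<theta> 2 (i + 1)) else 0)"

definition D3 :: "nat \<Rightarrow> (nat \<Rightarrow> real) \<Rightarrow> real mat" where
  "D3 n \<theta> = mat1 (n - 2) (n - 1) (\<lambda>i j.
     if j = i then inverse (hh \<theta> 3 i)
     else if j = i + 1 then - inverse (hh \<theta> 3 (i + 1)) else 0)"

definition alpha :: "nat \<Rightarrow> (nat \<Rightarrow> real) \<Rightarrow> nat \<Rightarrow> real" where
  "alpha n \<theta> j =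
     (if j = 0 \<or> j = n then 0 else (\<theta> (j + 2) - \<theta> (j + 1))\<^sup>2 / (\<theta> (j + 3) - \<theta> j))"

definition S_diag :: "nat \<Rightarrow> (nat \<Rightarrow> real) \<Rightarrow> nat \<Rightarrow> real" where
  "S_diag n \<theta> j =
     2 / (\<theta> (j + 2) - \<theta> j)
     + 2 / (\<theta> (j + 2) - \<theta> j)\<^sup>2 * (alpha n \<theta> (j - 1) + alpha n \<theta> j)"

definition S_off :: "(nat \<Rightarrow> real) \<Rightarrow> nat \<Rightarrow> real" where
  "S_off \<theta> j =
     - (2 * (\<theta> (j + 2) - \<theta> (j + 1))\<^sup>2
        / ((\<theta> (j + 2) - \<theta> j) * (\<theta> (j + 3) - \<theta> j) * (\<theta> (j + 3) - \<theta> (j + 1))))"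

definition S_mat :: "nat \<Rightarrow> (nat \<Rightarrow> real) \<Rightarrow> real mat" where
  "S_mat n \<theta> = mat1 n n (\<lambda>i j.
     if i = j then S_diag n \<theta> j
     else if i = j + 1 then S_off \<theta> j
     else if j = i + 1 then S_off \<theta> i
     else 0)"

definition kappa :: "(nat \<Rightarrow> real) \<Rightarrow> nat \<Rightarrow> real" where
  "kappa \<theta> l =
     (\<theta> l - \<theta> (l - 1))\<^sup>2 * (\<theta> (l + 1) - \<theta> l)\<^sup>2 / (18 * (\<theta> (l + 1) - \<theta> (l - 1)))"

definition A_mat ::
  "nat \<Rightarrow> real \<Rightarrow> real \<Rightarrow> (nat \<Rightarrow> real) \<Rightarrow> nat \<Rightarrow> (nat \<Rightarrow> nat) \<Rightarrow> real mat" where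
  "A_mat n a b \<theta> r l = mat1 r (n - 2) (\<lambda>j k. bspline a b \<theta> 4 k (\<theta> (l j)))"

definition B_mat :: "nat \<Rightarrow> (nat \<Rightarrow> real) \<Rightarrow> nat \<Rightarrow> (nat \<Rightarrow> nat) \<Rightarrow> real mat" where
  "B_mat n \<theta> r l = mat1 r (n - 2) (\<lambda>j k. if k = l j - 2 then kappa \<theta> (l j) else 0)"

definition S_L :: "nat \<Rightarrow> (nat \<Rightarrow> real) \<Rightarrow> real mat \<Rightarrow> real mat" where
  "S_L n \<theta> U =
     S_mat n \<theta>
     + transpose_mat (D2 n \<theta>) * transpose_mat (D3 n \<theta>) * U * D3 n \<theta> * D2 n \<theta>"

definition kernel_L ::
  "nat \<Rightarrow> real \<Rightarrow> real \<Rightarrow> (nat \<Rightarrow> real) \<Rightarrow> real mat \<Rightarrow> real \<Rightarrow> real \<Rightarrow> real" where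
  "kernel_L n a b \<theta> U x y = Phi2 n a b \<theta> y \<bullet> (S_L n \<theta> U *\<^sub>v Phi2 n a b \<theta> x)"

definition reproduces :: "real \<Rightarrow> real \<Rightarrow> (real \<Rightarrow> real \<Rightarrow> real) \<Rightarrow> (real \<Rightarrow> real) \<Rightarrow> bool" where
  "reproduces a b L p \<longleftrightarrow>
     (\<forall>x\<in>{a..b}. ((\<lambda>y. p y * L x y) has_integral p x) {a..b})"

end

theory Submission
  imports Defs
begin

text \<open>
  Let \<open>p\<close> be affine on each knot interval, with slope \<open>\<sigma>\<^sub>i\<close> on \<open>[\<theta>\<^sub>i, \<theta>\<^sub>i\<^sub>+\<^sub>1]\<close>, and let \<open>m\<close> be the vector of
  its moments against the \<open>N\<^sub>2\<^sub>,\<^sub>k\<close>. Since \<open>p\<close> is the linear spline with coefficients \<open>p(\<theta>\<^sub>k\<^sub>+\<^sub>1)\<close>, it suffices to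
  show that \<open>m\<^sup>T S\<^sub>L\<close> is the vector of these coefficients. The matrix \<open>S\<close> is the diagonal matrix with
  entries \<open>2 / (\<theta>\<^sub>k\<^sub>+\<^sub>2 - \<theta>\<^sub>k)\<close> plus \<open>D\<^sub>2\<^sup>T diag(\<alpha>\<^sub>k / 2) D\<^sub>2\<close>, and two summations by parts turn
  \<open>m\<^sup>T S\<close> into the coefficient vector minus the sum of the rows \<open>i - 2\<close> of \<open>D\<^sub>3 D\<^sub>2\<close> weighted by
  \<open>\<kappa>\<^sub>i (\<sigma>\<^sub>i - \<sigma>\<^sub>i\<^sub>-\<^sub>1)\<close>. The second part of \<open>S\<^sub>L\<close> must supply the defect. Writing \<open>p = f''\<close>, the
  entries of \<open>D\<^sub>3 D\<^sub>2 m\<close> are multiples of fourth divided differences of \<open>f\<close>: they vanish for affine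
  \<open>p\<close> and equal \<open>N\<^sub>4\<^sub>,\<^sub>k(\<theta>\<^sub>l)\<close> for \<open>p(x) = (\<theta>\<^sub>l - x)\<^sub>+\<close>, which is where \<open>A U\<^sub>2 = B\<close> enters.
\<close>

no_notation vec_nth (infixl "$" 90)

section \<open>Summation by parts and sums over tridiagonal arrays\<close>

text \<open>Both summations by parts of the main computation are instances in which \<open>A\<close>
  vanishes at \<open>0\<close> and at \<open>Suc M\<close>, so that the boundary terms drop
  out.\<close>

lemma sum_abel:
  fixes A x :: "nat \<Rightarrow> real"
  shows "(\<Sum>i<M. A (Suc i) * (x i - x (Suc i))) =
    (\<Sum>j<Suc M. (A (Suc j) - A j) * x j) + A 0 * x 0 - A (Suc M) * x M"
  by (induction M) (auto simp: algebra_simps)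

text \<open>Each weight is collected with the two terms that it touches. The application takes
  \<open>alpha n \<theta>\<close> for \<open>A\<close>; its values at \<open>0\<close> and
  \<open>n\<close> are 0, so no boundary terms remain.\<close>

lemma sum_adjacent:
  fixes A y :: "nat \<Rightarrow> real"
  shows "(\<Sum>i<Suc N. (A i + A (Suc i)) * y i) =
    (\<Sum>i<N. A (Suc i) * (y i + y (Suc i))) + A 0 * y 0 + A (Suc N) * y N"
  by (induction N) (auto simp: algebra_simps)

text \<open>Induction on the size: besides the new diagonal entry, the added row and the added
  column have at most one nonzero entry each.\<close>

lemma sum_tridiagonal:
  fixes m \<phi> d e :: "nat \<Rightarrow> real"
  shows "(\<Sum>i<Suc N. m i * (\<Sum>j<Suc N. (if i = j then d i else if i = Suc j then e j
      else if j = Suc i then e i else 0) * \<phi> j)) =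
    (\<Sum>i<Suc N. d i * m i * \<phi> i) + (\<Sum>i<N. e i * (m (Suc i) * \<phi> i + m i * \<phi> (Suc i)))"
proof (induction N)
  case 0
  then show ?case by simp
next
  case (Suc N)
  define T where "T = (\<lambda>i j. if i = j then d i else if i = Suc j then e j
      else if j = Suc i then e i else 0)"
  have row: "(\<Sum>j<Suc N. T (Suc N) j * \<phi> j) = e N * \<phi> N"
    by (simp add: T_def)
  have col: "(\<Sum>i<Suc N. m i * (T i (Suc N) * \<phi> (Suc N))) = m N * e N * \<phi> (Suc N)"
    by (simp add: T_def)
  have "(\<Sum>i<Suc (Suc N). m i * (\<Sum>j<Suc (Suc N). T i j * \<phi> j)) =
     (\<Sum>i<Suc N. m i * (\<Sum>j<Suc N. T i j * \<phi> j)) + (\<Sum>i<Suc N. m i * (T i (Suc N) * \<phi> (Suc N)))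
     + m (Suc N) * ((\<Sum>j<Suc N. T (Suc N) j * \<phi> j) + T (Suc N) (Suc N) * \<phi> (Suc N))"
    by (simp only: sum.lessThan_Suc[of _ "Suc N"] distrib_left sum.distrib)
  also have "\<dots> = (\<Sum>i<Suc (Suc N). d i * m i * \<phi> i)
      + (\<Sum>i<Suc N. e i * (m (Suc i) * \<phi> i + m i * \<phi> (Suc i)))"
    unfolding row col using Suc.IH[folded T_def] by (simp add: T_def algebra_simps)
  finally show ?case unfolding T_def .
qed

section \<open>Action of the difference matrices on vectors\<close>

lemma mat1_bidiagonal_mult_vec:
  assumes "dim_vec v = nc" "i < nr" "i + 1 < nc"
  shows "(mat1 nr nc (\<lambda>i j. if j = i then f i else if j = i + 1 then g i else 0) *\<^sub>v v) $ i
    = f (i + 1) * v $ i + g (i + 1) * v $ (i + 1)"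
proof -
  have "(mat1 nr nc (\<lambda>i j. if j = i then f i else if j = i + 1 then g i else 0) *\<^sub>v v) $ i
    = (\<Sum>j\<in>{0..<nc}. (if j = i then f (i+1) * v $ j else 0) + (if j = i + 1 then g (i+1) * v $ j else 0))"
    using assms unfolding mat1_def by (auto simp: scalar_prod_def intro!: sum.cong)
  also have "\<dots> = f (i + 1) * v $ i + g (i + 1) * v $ (i + 1)"
    using assms by (simp only: sum.distrib sum.delta finite_atLeastLessThan) simp
  finally show ?thesis .
qed

lemma D2_mult_vec:
  assumes "v \<in> carrier_vec n" "i < n - 1"
  shows "(D2 n \<theta> *\<^sub>v v) $ i =
    2 * (v $ i / (\<theta> (i + 3) - \<theta> (i + 1)) - v $ (i + 1) / (\<theta> (i + 4) - \<theta> (i + 2)))"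
proof -
  have "(D2 n \<theta> *\<^sub>v v) $ i = inverse (hh \<theta> 2 (i+1)) * v $ i + - inverse (hh \<theta> 2 (i + 2)) * v $ (i + 1)"
    unfolding D2_def using assms by (subst mat1_bidiagonal_mult_vec) auto
  then show ?thesis by (simp add: hh_def eval_nat_numeral field_simps)
qed

lemma D3_mult_vec:
  assumes "v \<in> carrier_vec (n - 1)" "i < n - 2"
  shows "(D3 n \<theta> *\<^sub>v v) $ i =
    3 * (v $ i / (\<theta> (i + 4) - \<theta> (i + 1)) - v $ (i + 1) / (\<theta> (i + 5) - \<theta> (i + 2)))"
proof -
  have "(D3 n \<theta> *\<^sub>v v) $ i = inverse (hh \<theta> 3 (i+1)) * v $ i + - inverse (hh \<theta> 3 (i + 2)) * v $ (i + 1)"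
    unfolding D3_def using assms by (subst mat1_bidiagonal_mult_vec) auto
  then show ?thesis by (simp add: hh_def eval_nat_numeral field_simps)
qed

lemma mat_carriers [simp]:
  "D2 n \<theta> \<in> carrier_mat (n - 1) n" "D3 n \<theta> \<in> carrier_mat (n - 2) (n - 1)"
  "S_mat n \<theta> \<in> carrier_mat n n"
  by (auto simp: D2_def D3_def S_mat_def mat1_def)

section \<open>Local identities for adjacent knot intervals\<close>

text \<open>Here \<open>u\<close>, \<open>v\<close>, \<open>w\<close> are consecutive knot
  distances, \<open>s1\<close>, \<open>s2\<close>, \<open>s3\<close> the slopes there,
  \<open>c1\<close>, \<open>c2\<close> the values at the two ends of the middle interval, and
  \<open>m1\<close>, \<open>m2\<close> the moments against the hats centred at these ends. The outer
  lengths may be 0 because of the double end knots. Continuing the middle slope to both outer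
  intervals gives the term in \<open>s2\<close>; the slope jumps give the rest.\<close>

lemma two_cell_identity:
  fixes u v w :: real
  assumes "0 \<le> u" "0 < v" "0 \<le> w"
    and m1: "m1 = c1 * (u + v) / 2 + (s2 * v\<^sup>2 - s1 * u\<^sup>2) / 6"
    and m2: "m2 = c2 * (v + w) / 2 + (s3 * w\<^sup>2 - s2 * v\<^sup>2) / 6"
    and c2: "c2 = c1 + s2 * v"
  shows "v\<^sup>2 / (u + v + w) * (2 * (m1 / (u + v) - m2 / (v + w))) =
    - (s2 * v\<^sup>2 / 3) - 6 / (u + v + w) *
      (v\<^sup>2 * w\<^sup>2 / (18 * (v + w)) * (s3 - s2) - u\<^sup>2 * v\<^sup>2 / (18 * (u + v)) * (s2 - s1))"
proof -
  have nz: "u + v \<noteq> 0" "v + w \<noteq> 0" "u + v + w \<noteq> 0" using assms by linarith+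
  have q1: "2 * (m1 / (u + v)) = c1 + s2 * (v - u) / 3 + (s2 - s1) * u\<^sup>2 / (3 * (u + v))"
    using nz unfolding m1 by (simp add: divide_simps) (simp add: power2_eq_square algebra_simps)
  have q2: "2 * (m2 / (v + w)) = c2 + s2 * (w - v) / 3 + (s3 - s2) * w\<^sup>2 / (3 * (v + w))"
    using nz unfolding m2 by (simp add: divide_simps) (simp add: power2_eq_square algebra_simps)
  have "2 * (m1 / (u + v) - m2 / (v + w)) = - (s2 * (u + v + w) / 3)
      + (s2 - s1) * u\<^sup>2 / (3 * (u + v)) - (s3 - s2) * w\<^sup>2 / (3 * (v + w))"
  proof -
    have "c1 + s2 * (v - u) / 3 + x - (c1 + s2 * v + s2 * (w - v) / 3 + y) =
      - (s2 * (u + v + w) / 3) + x - y" for x y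
      by (simp add: field_simps)
    then show ?thesis unfolding right_diff_distrib q1 q2 c2 .
  qed
  then have "v\<^sup>2 / (u + v + w) * (2 * (m1 / (u + v) - m2 / (v + w))) =
     v\<^sup>2 / (u + v + w) * (- (s2 * (u + v + w) / 3)
      + (s2 - s1) * u\<^sup>2 / (3 * (u + v)) - (s3 - s2) * w\<^sup>2 / (3 * (v + w)))"
    by (rule arg_cong)
  \<comment> \<open>The widths become single variables, so that clearing denominators does not
    expand the sums.\<close>
  moreover have reduce: "x / t * (- (s2 * t / 3) + (s2 - s1) * u\<^sup>2 / (3 * p) - (s3 - s2) * w\<^sup>2 / (3 * q)) =
    - (s2 * x / 3) - 6 / t * (x * w\<^sup>2 / (18 * q) * (s3 - s2) - u\<^sup>2 * x / (18 * p) * (s2 - s1))"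
    if "t \<noteq> 0" "p \<noteq> 0" "q \<noteq> 0" for x t p q
    using that by (simp add: field_simps)
  ultimately show ?thesis using reduce[OF nz(3,1,2)] by (simp only:)
qed

text \<open>With \<open>A\<close> an \<open>alpha\<close> value, the left side is everything that
  this value contributes to the form of \<open>S_mat\<close>, on and off the diagonal; the right
  side shows it as a product of two entries of \<open>D2\<close> images.\<close>

lemma weighted_square_expand:
  fixes A :: real
  shows "A * (2 * p * q / W\<^sup>2 + 2 * r * s / Z\<^sup>2) + - 2 * A / (W * Z) * (r * q + p * s) =
    A * (2 * (p / W - r / Z)) * (2 * (q / W - s / Z)) / 2"
proof -
  have "A * (2 * x * y + 2 * z * w) + - 2 * A * (z * y + x * w) = A * (2 * (x - z)) * (2 * (y - w)) / 2"
    for x y z w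
    by (simp add: algebra_simps)
  from this[of "p / W" "q / W" "r / Z" "s / Z"] show ?thesis
    by (simp add: power2_eq_square add_divide_distrib distrib_left mult.commute)
qed

section \<open>Derivatives of truncated powers\<close>

lemma trunc_pow_has_derivative_left:
  assumes "t < x"
  shows "(trunc_pow (Suc 0) x has_real_derivative 0) (at t)"
  by (rule has_field_derivative_transform_within_open[where f = "\<lambda>_. 0" and S = "{..<x}"])
    (use assms in \<open>auto simp: trunc_pow_def\<close>)

lemma trunc_pow_has_derivative_right:
  assumes "x < t"
  shows "(trunc_pow (Suc 0) x has_real_derivative 1) (at t)"
  by (rule has_field_derivative_transform_within_open[where f = "\<lambda>t. t - x" and S = "{x<..}"])
    (use assms in \<open>auto simp: trunc_pow_def intro!: derivative_eq_intros\<close>)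

text \<open>Away from \<open>c\<close> the function is locally a polynomial. At \<open>c\<close>
  itself the exponent of at least 2 forces the difference quotient to 0.\<close>

lemma max_pow_has_derivative:
  fixes c t :: real
  shows "((\<lambda>t. max 0 (c - t) ^ Suc (Suc k)) has_real_derivative - (Suc (Suc k) * max 0 (c - t) ^ Suc k)) (at t)"
proof (cases t c rule: linorder_cases)
  case less
  then have "((\<lambda>t. (c - t) ^ Suc (Suc k)) has_real_derivative
      - (Suc (Suc k) * max 0 (c - t) ^ Suc k)) (at t)"
    using DERIV_power[OF DERIV_diff[OF DERIV_const[of c] DERIV_ident], of "Suc (Suc k)" t]
    by (simp add: max_def)
  then show ?thesis
    by (rule has_field_derivative_transform_within_open[where S = "{..<c}"])
      (use less in \<open>auto simp: max_def\<close>)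
next
  case greater
  then have "((\<lambda>t. 0) has_real_derivative - (Suc (Suc k) * max 0 (c - t) ^ Suc k)) (at t)"
    by (auto simp: max_def)
  then show ?thesis
    by (rule has_field_derivative_transform_within_open[where S = "{c<..}"])
      (use greater in \<open>auto simp: max_def\<close>)
next
  case equal
  have "((\<lambda>h :: real. max 0 (- h) ^ Suc (Suc k) / h) \<longlongrightarrow> 0) (at 0)"
  proof (rule Lim_null_comparison)
    have "norm (max 0 (- h) ^ Suc (Suc k) / h) \<le> \<bar>h\<bar> ^ Suc k" if "h \<noteq> 0" for h :: real
      using that by (cases "h > 0") (simp_all add: max_def abs_mult power_abs)
    then show "\<forall>\<^sub>F h in at 0. norm (max 0 (- h) ^ Suc (Suc k) / h) \<le> \<bar>h\<bar> ^ Suc k"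
      by (auto simp: eventually_at_filter)
    have "((\<lambda>h :: real. \<bar>h\<bar> ^ Suc k) \<longlongrightarrow> \<bar>0\<bar> ^ Suc k) (at 0)" by (intro tendsto_intros)
    then show "((\<lambda>h :: real. \<bar>h\<bar> ^ Suc k) \<longlongrightarrow> 0) (at 0)" by simp
  qed
  then show ?thesis unfolding DERIV_def equal by simp
qed

section \<open>Order of the knots, with double knots at both ends\<close>

locale knots =
  fixes n :: nat and a b :: real and \<theta> :: "nat \<Rightarrow> real"
  assumes knot_vector: "knot_vector n a b \<theta>"
begin

lemma n2: "2 \<le> n" and ends: "\<theta> 1 = a" "\<theta> (Suc 0) = a" "\<theta> 2 = a" "\<theta> (Suc (Suc 0)) = a" "\<theta> (n + 1) = b" "\<theta> (n + 2) = b"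
  "\<theta> (Suc n) = b" "\<theta> (Suc (Suc n)) = b"
  using knot_vector by (auto simp: knot_vector_def numeral_2_eq_2)

lemma knot_less: "2 \<le> i \<Longrightarrow> i < j \<Longrightarrow> j \<le> n + 1 \<Longrightarrow> \<theta> i < \<theta> j"
  using knot_vector by (auto simp: knot_vector_def strict_mono_on_def)

lemma knot_le:
  assumes "1 \<le> i" "i \<le> j" "j \<le> n + 2"
  shows "\<theta> i \<le> \<theta> j"
proof -
  \<comment> \<open>Clamping the index to the range from \<open>2\<close> to \<open>n + 1\<close>
    keeps the knot, since only the end knots are repeated; on that range the knots increase
    strictly.\<close>
  have "\<theta> (max 2 (min i (n + 1))) = \<theta> i" "\<theta> (max 2 (min j (n + 1))) = \<theta> j"
    using assms n2 ends by (cases "i = 1"; cases "i = n + 2"; cases "j = 1"; cases "j = n + 2";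
      simp add: max_def min_def)+
  moreover have "\<theta> (max 2 (min i (n + 1))) \<le> \<theta> (max 2 (min j (n + 1)))"
    using knot_less[of "max 2 (min i (n + 1))" "max 2 (min j (n + 1))"] assms n2
    by (cases "max 2 (min i (n + 1)) = max 2 (min j (n + 1))") (auto simp: max_def min_def)
  ultimately show ?thesis by simp
qed

text \<open>No knot has multiplicity above 2, so two index steps always cross an interval of
  positive length.\<close>

lemma knot_less_skip:
  assumes "1 \<le> i" "i + 2 \<le> j" "j \<le> n + 2"
  shows "\<theta> i < \<theta> j"
proof (cases "i = n")
  case True
  then have "\<theta> i < \<theta> (i + 1)" using n2 by (intro knot_less) auto
  also have "\<theta> (i + 1) \<le> \<theta> j" using assms by (intro knot_le) auto
  finally show ?thesis .
next
  case False
  have "\<theta> i \<le> \<theta> (i + 1)" using assms by (intro knot_le) auto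
  also have "\<theta> (i + 1) < \<theta> (i + 2)" using False assms by (intro knot_less) auto
  also have "\<theta> (i + 2) \<le> \<theta> j" using assms by (intro knot_le) auto
  finally show ?thesis .
qed

lemma a_less_b: "a < b"
  using knot_less[of 2 "n + 1"] n2 ends by simp

section \<open>Linear B-splines as differences of ramps\<close>

text \<open>
  On \<open>[a, b]\<close> the hat function \<open>N\<^sub>2\<^sub>,\<^sub>i\<close> is \<open>ramp i - ramp (i + 1)\<close>; the first and the last ramp belong to
  the double end knots, where the quotient would be a division by 0.
\<close>

definition ramp :: "nat \<Rightarrow> real \<Rightarrow> real" where
  "ramp i x = (if i = 1 then 1 else if i = n + 1 then 0
     else max 0 (min 1 ((x - \<theta> i) / (\<theta> (i + 1) - \<theta> i))))"

text \<open>At the double knots the divided difference is a derivative of the truncated power, which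
  is 0 at \<open>a\<close> and 1 at \<open>b\<close> because \<open>x\<close> lies strictly between;
  this is what fixes the constant values of the first and the last ramp.\<close>

lemma divdiff_trunc_pow_1:
  assumes "1 \<le> i" "i \<le> n + 1" "a < x" "x < b"
  shows "divdiff \<theta> (trunc_pow (Suc 0) x) i (Suc 0) = 1 - ramp i x"
proof -
  consider "i = 1" | "i = n + 1" | "2 \<le> i" "i \<le> n" using assms by linarith
  then show ?thesis
  proof cases
    case 1
    then show ?thesis using ends assms DERIV_imp_deriv[OF trunc_pow_has_derivative_left[of a x]]
      by (simp add: ramp_def eval_nat_numeral)
  next
    case 2
    then show ?thesis using ends assms n2 DERIV_imp_deriv[OF trunc_pow_has_derivative_right[of x b]]
      by (simp add: ramp_def)
  next
    case 3
    then have "\<theta> i < \<theta> (Suc i)" by (intro knot_less) auto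
    then show ?thesis using 3
      by (auto simp: ramp_def trunc_pow_def max_def min_def divide_simps)
  qed
qed

lemma bspline_raw_2:
  assumes "1 \<le> i" "i \<le> n" "a < x" "x < b"
  shows "bspline_raw \<theta> 2 i x = ramp i x - ramp (i + 1) x"
proof -
  have "\<theta> i < \<theta> (i + 2)" using assms by (intro knot_less_skip) auto
  then show ?thesis
    using divdiff_trunc_pow_1[of i x] divdiff_trunc_pow_1[of "Suc i" x] assms
    by (simp add: bspline_raw_def numeral_2_eq_2 del: divdiff.simps(2)) (simp add: divdiff.simps(2)[of _ _ _ "Suc 0"])
qed

lemma isCont_ramp: "isCont (ramp i) x"
proof (cases "i = 1 \<or> i = n + 1")
  case True
  then have "ramp i = (\<lambda>_. 1) \<or> ramp i = (\<lambda>_. 0)"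
    by (auto simp: ramp_def fun_eq_iff)
  then show ?thesis by auto
next
  case False
  \<comment> \<open>Multiplication by a constant inverse makes continuity free of side conditions on
    the denominator.\<close>
  then have "ramp i = (\<lambda>x. max 0 (min 1 ((x - \<theta> i) * inverse (\<theta> (i + 1) - \<theta> i))))"
    by (auto simp: ramp_def field_simps)
  then show ?thesis by (auto intro!: continuous_intros)
qed

text \<open>The ramps are continuous, so the one-sided limits that define \<open>bspline\<close> at
  \<open>a\<close> and \<open>b\<close> are values of the same expression as inside.\<close>

lemma bspline_2:
  assumes "1 \<le> i" "i \<le> n" "x \<in> {a..b}"
  shows "bspline a b \<theta> 2 i x = ramp i x - ramp (i + 1) x"
proof -
  have cont: "((\<lambda>x. ramp i x - ramp (i + 1) x) \<longlongrightarrow> ramp i y - ramp (i + 1) y) (at y within A)" for y :: real and A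
    using isCont_ramp[of y i] isCont_ramp[of y "i + 1"]
    by (intro tendsto_diff) (auto simp: isCont_def intro: tendsto_within_subset)
  have "eventually (\<lambda>x. a < x \<and> x < b) (at_right a)"
    using a_less_b by (auto simp: eventually_at_right)
  then have "eventually (\<lambda>x. ramp i x - ramp (i + 1) x = bspline_raw \<theta> 2 i x) (at_right a)"
    by eventually_elim (use bspline_raw_2 assms in auto)
  then have A: "Lim (at_right a) (bspline_raw \<theta> 2 i) = ramp i a - ramp (i + 1) a"
    by (intro tendsto_Lim tendsto_cong[THEN iffD1, OF _ cont]) auto
  have "eventually (\<lambda>x. a < x \<and> x < b) (at_left b)"
    using a_less_b by (auto simp: eventually_at_left)
  then have "eventually (\<lambda>x. ramp i x - ramp (i + 1) x = bspline_raw \<theta> 2 i x) (at_left b)"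
    by eventually_elim (use bspline_raw_2 assms in auto)
  then have B: "Lim (at_left b) (bspline_raw \<theta> 2 i) = ramp i b - ramp (i + 1) b"
    by (intro tendsto_Lim tendsto_cong[THEN iffD1, OF _ cont]) auto
  show ?thesis using A B bspline_raw_2[of i x] assms by (auto simp: bspline_def)
qed

section \<open>Moments against linear B-splines\<close>

text \<open>Integration by parts: the ramp is 0 before its interval, rises linearly to 1 on it and
  stays there, so the mean of \<open>g\<close> over the interval is subtracted from
  \<open>g b\<close>. At a double end knot that mean degenerates to the derivative of
  \<open>f\<close>.\<close>

lemma has_integral_times_ramp:
  fixes f g p :: "real \<Rightarrow> real"
  assumes f: "\<And>t. (f has_real_derivative g t) (at t)" and g: "\<And>t. (g has_real_derivative p t) (at t)"
    and i: "1 \<le> i" "i \<le> n + 1"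
  shows "((\<lambda>y. p y * ramp i y) has_integral g b - divdiff \<theta> f i (Suc 0)) {a..b}"
proof -
  have gint: "(p has_integral g t - g s) {s..t}" if "s \<le> t" for s t
    using that g by (intro fundamental_theorem_of_calculus)
      (auto simp: has_real_derivative_iff_has_vector_derivative[symmetric] intro: has_field_derivative_at_within)
  consider "i = 1" | "i = n + 1" | "2 \<le> i" "i \<le> n" using i by linarith
  then show ?thesis
  proof cases
    case 1
    then show ?thesis using gint[of a b] ends a_less_b DERIV_imp_deriv[OF f]
      by (simp add: ramp_def eval_nat_numeral)
  next
    case 2
    then show ?thesis using ends n2 DERIV_imp_deriv[OF f] by (simp add: ramp_def)
  next
    case 3
    define s t where "s = \<theta> i" and "t = \<theta> (Suc i)"
    have st: "s < t" unfolding s_def t_def using 3 by (intro knot_less) auto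
    have as: "a \<le> s" using knot_le[of 2 i] 3 ends by (simp add: s_def)
    have tb: "t \<le> b" using knot_le[of "Suc i" "n + 1"] 3 ends by (simp add: t_def)
    have r: "ramp i y = max 0 (min 1 ((y - s) / (t - s)))" for y
      using 3 by (simp add: ramp_def s_def t_def)
    have "((\<lambda>y. p y * ramp i y) has_integral 0) {a..s}"
      by (rule has_integral_is_0) (use st in \<open>auto simp: r max_def min_def divide_simps\<close>)
    moreover have "((\<lambda>y. p y * ramp i y) has_integral g t - (f t - f s) / (t - s)) {s..t}"
    proof (rule has_integral_eq)
      define c where "c = inverse (t - s)"
      \<comment> \<open>The antiderivative that integration by parts yields for \<open>p\<close>
        times a linear factor.\<close>
      define F where "F = (\<lambda>y. (y - s) * c * g y - f y * c)"
      have "((\<lambda>y. p y * ((y - s) / (t - s))) has_integral F t - F s) {s..t}"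
      proof (rule fundamental_theorem_of_calculus)
        show "s \<le> t" using st by simp
        have "(F has_real_derivative p y * ((y - s) / (t - s))) (at y)" for y
          unfolding F_def divide_inverse c_def[symmetric]
          by (auto intro!: derivative_eq_intros f g simp: algebra_simps)
        then show "(F has_vector_derivative p y * ((y - s) / (t - s))) (at y within {s..t})" for y
          by (auto simp: has_real_derivative_iff_has_vector_derivative[symmetric] intro: has_field_derivative_at_within)
      qed
      also have "F t - F s = g t - (f t - f s) / (t - s)"
      proof -
        have "(t - s) * c = 1" using st by (simp add: c_def)
        moreover have "F t - F s = ((t - s) * c) * g t - (f t - f s) * c"
          by (simp add: F_def algebra_simps)
        ultimately show ?thesis by (simp add: divide_inverse c_def)
      qed
      finally show "((\<lambda>y. p y * ((y - s) / (t - s))) has_integral g t - (f t - f s) / (t - s)) {s..t}" .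
    qed (use st in \<open>auto simp: r\<close>)
    ultimately have "((\<lambda>y. p y * ramp i y) has_integral 0 + (g t - (f t - f s) / (t - s))) {a..t}"
      by (rule has_integral_combine[rotated 2]) (use st as in auto)
    moreover have "((\<lambda>y. p y * ramp i y) has_integral g b - g t) {t..b}"
      by (rule has_integral_eq[OF _ gint[OF tb]]) (use st in \<open>auto simp: r max_def min_def divide_simps\<close>)
    ultimately have "((\<lambda>y. p y * ramp i y) has_integral
        0 + (g t - (f t - f s) / (t - s)) + (g b - g t)) {a..b}"
      by (rule has_integral_combine[rotated 2]) (use st as tb in auto)
    then show ?thesis using st by (simp add: s_def t_def)
  qed
qed

text \<open>The common term \<open>g b\<close> cancels between the two ramps.\<close>

lemma has_integral_times_bspline:
  fixes f g p :: "real \<Rightarrow> real"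
  assumes "\<And>t. (f has_real_derivative g t) (at t)" "\<And>t. (g has_real_derivative p t) (at t)"
    and i: "1 \<le> i" "i \<le> n"
  shows "((\<lambda>y. p y * bspline a b \<theta> 2 i y) has_integral
    divdiff \<theta> f (i + 1) (Suc 0) - divdiff \<theta> f i (Suc 0)) {a..b}"
proof (rule has_integral_eq)
  show "((\<lambda>y. p y * ramp i y - p y * ramp (i + 1) y) has_integral
    divdiff \<theta> f (i + 1) (Suc 0) - divdiff \<theta> f i (Suc 0)) {a..b}"
    using has_integral_diff[OF has_integral_times_ramp[OF assms(1,2), of i]
      has_integral_times_ramp[OF assms(1,2), of "i + 1"]] i by simp
qed (simp add: bspline_2[OF i] algebra_simps)

section \<open>Piecewise affine functions as linear splines\<close>

text \<open>The slopes \<open>\<sigma> 1\<close> and \<open>\<sigma> (n + 1)\<close> stay free: they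
  belong to the intervals of length 0 at the double end knots and later occur only with a factor
  0.\<close>

definition piecewise_affine :: "(nat \<Rightarrow> real) \<Rightarrow> (real \<Rightarrow> real) \<Rightarrow> bool" where
  "piecewise_affine \<sigma> p \<longleftrightarrow>
    (\<forall>i\<in>{2..n}. \<forall>y\<in>{\<theta> i..\<theta> (i + 1)}. p y = p (\<theta> i) + \<sigma> i * (y - \<theta> i))"

text \<open>In terms of ramps, the sum starts at \<open>p a\<close> and adds the increment of
  \<open>p\<close> over each knot interval in turn.\<close>

lemma sum_bspline_2:
  assumes p: "piecewise_affine \<sigma> p" and x: "x \<in> {a..b}"
  shows "(\<Sum>i<n. p (\<theta> (i + 2)) * bspline a b \<theta> 2 (i + 1) x) = p x"
proof -
  have cell: "p (min x (\<theta> i)) + (p (\<theta> (i + 1)) - p (\<theta> i)) * ramp i x = p (min x (\<theta> (i + 1)))"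
    if i: "2 \<le> i" "i \<le> n" for i
  proof -
    have lt: "\<theta> i < \<theta> (i + 1)" using i by (intro knot_less) auto
    have aff: "p y = p (\<theta> i) + \<sigma> i * (y - \<theta> i)" if "\<theta> i \<le> y" "y \<le> \<theta> (i + 1)" for y
      using p[unfolded piecewise_affine_def, rule_format, of i y] i that by simp
    have r: "ramp i x = max 0 (min 1 ((x - \<theta> i) / (\<theta> (i + 1) - \<theta> i)))"
      using i by (simp add: ramp_def)
    consider "x \<le> \<theta> i" | "\<theta> i \<le> x" "x \<le> \<theta> (i + 1)" | "\<theta> (i + 1) \<le> x" by linarith
    then show ?thesis
    proof cases
      case 1
      then have "ramp i x = 0" using lt by (auto simp: r max_def min_def divide_simps)
      then show ?thesis using 1 lt by (simp add: min_def)
    next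
      case 2
      then have "ramp i x = (x - \<theta> i) / (\<theta> (i + 1) - \<theta> i)"
        using lt by (auto simp: r max_def min_def divide_simps)
      then show ?thesis using 2 lt aff[of x] aff[of "\<theta> (i + 1)"] by (simp add: min_def)
    next
      case 3
      then have "ramp i x = 1" using lt by (auto simp: r max_def min_def divide_simps)
      then show ?thesis using 3 lt by (simp add: min_def)
    qed
  qed
  \<comment> \<open>Partial sums reproduce \<open>p\<close> frozen beyond
    \<open>\<theta> (k + 1)\<close>; at \<open>k = n\<close> the extra ramp is 0 and nothing is
    frozen any more.\<close>
  have "(\<Sum>i<k. p (\<theta> (i + 2)) * (ramp (i + 1) x - ramp (i + 2) x))
      + p (\<theta> (k + 1)) * ramp (k + 1) x = p (min x (\<theta> (k + 1)))" if "1 \<le> k" "k \<le> n" for k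
    using that
  proof (induction k rule: dec_induct)
    case base
    then show ?case using cell[of 2] n2 ends x by (simp add: ramp_def algebra_simps eval_nat_numeral)
  next
    case (step k)
    then show ?case using cell[of "k + 1"] by (simp add: algebra_simps)
  qed
  from this[of n] show ?thesis using n2 x ends
    by (simp add: bspline_2 ramp_def)
qed

section \<open>The bilinear forms of \<open>S_mat\<close> and \<open>S_L\<close>\<close>

text \<open>Every \<open>alpha\<close> value enters two neighbouring diagonal entries and the
  off-diagonal pair between them. Sorting the form by these values leaves a diagonal part and a
  weighted product of \<open>D2\<close> images.\<close>

lemma S_mat_form:
  assumes m: "m \<in> carrier_vec n" and \<phi>: "\<phi> \<in> carrier_vec n"
  shows "m \<bullet> (S_mat n \<theta> *\<^sub>v \<phi>) = (\<Sum>i<n. 2 / (\<theta> (i + 3) - \<theta> (i + 1)) * m $ i * \<phi> $ i)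
    + (\<Sum>i<n - 1. alpha n \<theta> (i + 1) * (D2 n \<theta> *\<^sub>v m) $ i * (D2 n \<theta> *\<^sub>v \<phi>) $ i) / 2"
proof -
  obtain N where N: "n = Suc N" using n2 by (cases n) auto
  define W where "W = (\<lambda>i. \<theta> (i + 3) - \<theta> (i + 1))"
  have "m \<bullet> (S_mat n \<theta> *\<^sub>v \<phi>) = (\<Sum>i<Suc N. m $ i * (\<Sum>j<Suc N.
      (if i = j then S_diag n \<theta> (i + 1) else if i = Suc j then S_off \<theta> (j + 1)
      else if j = Suc i then S_off \<theta> (i + 1) else 0) * \<phi> $ j))"
  proof -
    have "S_mat n \<theta> $$ (i, j) = (if i = j then S_diag n \<theta> (i + 1) else if i = Suc j then S_off \<theta> (j + 1)
      else if j = Suc i then S_off \<theta> (i + 1) else 0)" if "i < n" "j < n" for i j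
      using that by (auto simp: S_mat_def mat1_def)
    moreover have "dim_row (S_mat n \<theta>) = n" "dim_col (S_mat n \<theta>) = n"
      by (simp_all add: S_mat_def mat1_def)
    ultimately show ?thesis
      using m \<phi> unfolding N[symmetric] by (simp add: scalar_prod_def atLeast0LessThan)
  qed
  also have "\<dots> = (\<Sum>i<Suc N. S_diag n \<theta> (i + 1) * m $ i * \<phi> $ i)
      + (\<Sum>i<N. S_off \<theta> (i + 1) * (m $ Suc i * \<phi> $ i + m $ i * \<phi> $ Suc i))"
    by (rule sum_tridiagonal)
  also have "(\<Sum>i<Suc N. S_diag n \<theta> (i + 1) * m $ i * \<phi> $ i) = (\<Sum>i<n. 2 / W i * m $ i * \<phi> $ i)
      + (\<Sum>i<Suc N. (alpha n \<theta> i + alpha n \<theta> (Suc i)) * (2 * m $ i * \<phi> $ i / (W i)\<^sup>2))"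
    unfolding N sum.distrib[symmetric]
    by (rule sum.cong) (simp_all add: S_diag_def W_def field_simps eval_nat_numeral)
  also have "(\<Sum>i<Suc N. (alpha n \<theta> i + alpha n \<theta> (Suc i)) * (2 * m $ i * \<phi> $ i / (W i)\<^sup>2)) =
      (\<Sum>i<N. alpha n \<theta> (Suc i) * (2 * m $ i * \<phi> $ i / (W i)\<^sup>2 + 2 * m $ Suc i * \<phi> $ Suc i / (W (Suc i))\<^sup>2))"
    by (subst sum_adjacent) (simp add: alpha_def N)
  finally have "m \<bullet> (S_mat n \<theta> *\<^sub>v \<phi>) = (\<Sum>i<n. 2 / W i * m $ i * \<phi> $ i)
      + (\<Sum>i<N. alpha n \<theta> (Suc i) * (2 * m $ i * \<phi> $ i / (W i)\<^sup>2 + 2 * m $ Suc i * \<phi> $ Suc i / (W (Suc i))\<^sup>2)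
         + S_off \<theta> (i + 1) * (m $ Suc i * \<phi> $ i + m $ i * \<phi> $ Suc i))"
    by (simp add: sum.distrib)
  also have "(\<Sum>i<N. alpha n \<theta> (Suc i) * (2 * m $ i * \<phi> $ i / (W i)\<^sup>2 + 2 * m $ Suc i * \<phi> $ Suc i / (W (Suc i))\<^sup>2)
         + S_off \<theta> (i + 1) * (m $ Suc i * \<phi> $ i + m $ i * \<phi> $ Suc i)) =
      (\<Sum>i<n - 1. alpha n \<theta> (i + 1) * (D2 n \<theta> *\<^sub>v m) $ i * (D2 n \<theta> *\<^sub>v \<phi>) $ i / 2)"
  proof (rule sum.cong)
    fix i assume "i \<in> {..<n - 1}"
    then have i: "i < n - 1" by simp
    have off: "S_off \<theta> (Suc i) = - 2 * alpha n \<theta> (Suc i) / (W i * W (Suc i))"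
    proof -
      have "Suc i \<noteq> n" using i by simp
      then show ?thesis by (simp add: S_off_def alpha_def W_def eval_nat_numeral)
    qed
    have D: "(D2 n \<theta> *\<^sub>v v) $ i = 2 * (v $ i / W i - v $ Suc i / W (Suc i))" if "v \<in> carrier_vec n" for v
      using D2_mult_vec[OF that i] by (simp add: W_def eval_nat_numeral)
    show "alpha n \<theta> (Suc i) * (2 * m $ i * \<phi> $ i / (W i)\<^sup>2 + 2 * m $ Suc i * \<phi> $ Suc i / (W (Suc i))\<^sup>2)
         + S_off \<theta> (i + 1) * (m $ Suc i * \<phi> $ i + m $ i * \<phi> $ Suc i) =
      alpha n \<theta> (i + 1) * (D2 n \<theta> *\<^sub>v m) $ i * (D2 n \<theta> *\<^sub>v \<phi>) $ i / 2"
      unfolding off D[OF m] D[OF \<phi>] Suc_eq_plus1[symmetric]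
      by (rule weighted_square_expand)
  qed (simp add: N)
  finally show ?thesis by (simp add: W_def sum_divide_distrib)
qed

text \<open>The two transposed factors move to the left argument, where \<open>D3\<close> and
  \<open>D2\<close> act on the moments.\<close>

lemma kernel_L_form:
  assumes m: "m \<in> carrier_vec n" and \<phi>: "\<phi> \<in> carrier_vec n" and U: "U \<in> carrier_mat (n - 2) (n - 2)"
  shows "m \<bullet> (S_L n \<theta> U *\<^sub>v \<phi>) = m \<bullet> (S_mat n \<theta> *\<^sub>v \<phi>)
    + (D3 n \<theta> *\<^sub>v (D2 n \<theta> *\<^sub>v m)) \<bullet> (U *\<^sub>v (D3 n \<theta> *\<^sub>v (D2 n \<theta> *\<^sub>v \<phi>)))"
proof -
  let ?D2 = "D2 n \<theta>" and ?D3 = "D3 n \<theta>"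
  note c = mat_carriers[of n \<theta>]
  define v where "v = U *\<^sub>v (?D3 *\<^sub>v (?D2 *\<^sub>v \<phi>))"
  have v: "v \<in> carrier_vec (n - 2)" unfolding v_def using U c \<phi> by (meson mult_mat_vec_carrier)
  have t2: "transpose_mat ?D2 \<in> carrier_mat n (n - 1)" and t3: "transpose_mat ?D3 \<in> carrier_mat (n - 1) (n - 2)"
    using c by auto
  have "transpose_mat ?D2 * transpose_mat ?D3 * U * ?D3 * ?D2 *\<^sub>v \<phi> =
    transpose_mat ?D2 *\<^sub>v (transpose_mat ?D3 *\<^sub>v v)"
  proof -
    have p1: "transpose_mat ?D2 * transpose_mat ?D3 \<in> carrier_mat n (n - 2)" using t2 t3 by auto
    have p2: "transpose_mat ?D2 * transpose_mat ?D3 * U \<in> carrier_mat n (n - 2)" using p1 U by auto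
    have p3: "transpose_mat ?D2 * transpose_mat ?D3 * U * ?D3 \<in> carrier_mat n (n - 1)" using p2 c by auto
    have w2: "?D2 *\<^sub>v \<phi> \<in> carrier_vec (n - 1)" using c \<phi> by (meson mult_mat_vec_carrier)
    have w3: "?D3 *\<^sub>v (?D2 *\<^sub>v \<phi>) \<in> carrier_vec (n - 2)" using c w2 by (meson mult_mat_vec_carrier)
    show ?thesis unfolding v_def
      using assoc_mult_mat_vec[OF p3 c(1) \<phi>] assoc_mult_mat_vec[OF p2 c(2) w2]
        assoc_mult_mat_vec[OF p1 U w3] assoc_mult_mat_vec[OF t2 t3 v[unfolded v_def]] by simp
  qed
  moreover have "transpose_mat ?D2 * transpose_mat ?D3 * U * ?D3 * ?D2 \<in> carrier_mat n n"
    using t2 t3 U c by (meson mult_carrier_mat)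
  ultimately have "S_L n \<theta> U *\<^sub>v \<phi> = S_mat n \<theta> *\<^sub>v \<phi> + transpose_mat ?D2 *\<^sub>v (transpose_mat ?D3 *\<^sub>v v)"
    unfolding S_L_def using add_mult_distrib_mat_vec[OF c(3) _ \<phi>] by simp
  moreover have t3v: "transpose_mat ?D3 *\<^sub>v v \<in> carrier_vec (n - 1)" using t3 v by (meson mult_mat_vec_carrier)
  moreover have t2v: "transpose_mat ?D2 *\<^sub>v (transpose_mat ?D3 *\<^sub>v v) \<in> carrier_vec n"
    using t2 t3v by (meson mult_mat_vec_carrier)
  moreover have Sv: "S_mat n \<theta> *\<^sub>v \<phi> \<in> carrier_vec n" using c \<phi> by (meson mult_mat_vec_carrier)
  moreover have D2m: "?D2 *\<^sub>v m \<in> carrier_vec (n - 1)" using c m by (meson mult_mat_vec_carrier)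
  moreover have D3m: "?D3 *\<^sub>v (?D2 *\<^sub>v m) \<in> carrier_vec (n - 2)" using c D2m by (meson mult_mat_vec_carrier)
  moreover have "m \<bullet> (transpose_mat ?D2 *\<^sub>v (transpose_mat ?D3 *\<^sub>v v)) = (?D3 *\<^sub>v (?D2 *\<^sub>v m)) \<bullet> v"
    using transpose_vec_mult_scalar[OF c(1) m t3v] transpose_vec_mult_scalar[OF c(2) D2m v]
      comm_scalar_prod[OF m t2v] comm_scalar_prod[OF D2m t3v] comm_scalar_prod[OF D3m v] by simp
  ultimately show ?thesis unfolding v_def[symmetric]
    using scalar_prod_add_distrib[OF m Sv t2v] by simp
qed

section \<open>The moment vector and the reproduction criterion\<close>

text \<open>By Peano's formula the entries are the integrals of \<open>f'' N\<^sub>2\<^sub>,\<^sub>i\<^sub>+\<^sub>1\<close>.\<close>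

definition moments :: "(real \<Rightarrow> real) \<Rightarrow> real vec" where
  "moments f = Matrix.vec n (\<lambda>i. divdiff \<theta> f (i + 2) (Suc 0) - divdiff \<theta> f (i + 1) (Suc 0))"

lemma moments_carrier: "moments f \<in> carrier_vec n"
  by (simp add: moments_def)

lemma has_integral_kernel_L:
  fixes f g p :: "real \<Rightarrow> real"
  assumes "\<And>t. (f has_real_derivative g t) (at t)" "\<And>t. (g has_real_derivative p t) (at t)"
    and U: "U \<in> carrier_mat (n - 2) (n - 2)"
  shows "((\<lambda>y. p y * kernel_L n a b \<theta> U x y) has_integral
    moments f \<bullet> (S_L n \<theta> U *\<^sub>v Phi2 n a b \<theta> x)) {a..b}"
proof -
  define v where "v = S_L n \<theta> U *\<^sub>v Phi2 n a b \<theta> x"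
  have v: "dim_vec v = n" by (simp add: v_def S_L_def D2_def mat1_def)
  have "((\<lambda>y. \<Sum>i<n. (p y * bspline a b \<theta> 2 (i + 1) y) * v $ i) has_integral
    (\<Sum>i<n. (divdiff \<theta> f (i + 1 + 1) (Suc 0) - divdiff \<theta> f (i + 1) (Suc 0)) * v $ i)) {a..b}"
    by (intro has_integral_sum has_integral_mult_left has_integral_times_bspline[OF assms(1,2)]) auto
  also have "(\<lambda>y. \<Sum>i<n. (p y * bspline a b \<theta> 2 (i + 1) y) * v $ i) = (\<lambda>y. p y * kernel_L n a b \<theta> U x y)"
    unfolding kernel_L_def v_def[symmetric]
    using v by (simp add: scalar_prod_def Phi2_def sum_distrib_left atLeast0LessThan mult.assoc)
  also have "(\<Sum>i<n. (divdiff \<theta> f (i + 1 + 1) (Suc 0) - divdiff \<theta> f (i + 1) (Suc 0)) * v $ i) = moments f \<bullet> v"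
    using v by (simp add: moments_def scalar_prod_def atLeast0LessThan)
  finally show ?thesis unfolding v_def .
qed

text \<open>Separates the computation common to both families of functions from what is special to
  each: \<open>mom\<close> is the moment of a hat in terms of the value at its centre and the two
  adjacent slopes, and \<open>jumps\<close> is the only demand on the entries of
  \<open>U\<close>.\<close>

lemma reproduces_piecewise_affine:
  fixes f g p :: "real \<Rightarrow> real"
  assumes f: "\<And>t. (f has_real_derivative g t) (at t)" and g: "\<And>t. (g has_real_derivative p t) (at t)"
    and U: "U \<in> carrier_mat (n - 2) (n - 2)"
    and p: "piecewise_affine \<sigma> p"
    and mom: "\<And>i. i < n \<Longrightarrow> moments f $ i = p (\<theta> (i + 2)) * (\<theta> (i + 3) - \<theta> (i + 1)) / 2
      + (\<sigma> (i + 2) * (\<theta> (i + 3) - \<theta> (i + 2))\<^sup>2 - \<sigma> (i + 1) * (\<theta> (i + 2) - \<theta> (i + 1))\<^sup>2) / 6"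
    and jumps: "\<And>v. v \<in> carrier_vec (n - 2) \<Longrightarrow>
      (D3 n \<theta> *\<^sub>v (D2 n \<theta> *\<^sub>v moments f)) \<bullet> (U *\<^sub>v v) =
      (\<Sum>k<n - 2. kappa \<theta> (k + 3) * (\<sigma> (k + 3) - \<sigma> (k + 2)) * v $ k)"
  shows "reproduces a b (kernel_L n a b \<theta> U) p"
  unfolding reproduces_def
proof
  fix x assume x: "x \<in> {a..b}"
  define \<phi> where "\<phi> = Phi2 n a b \<theta> x"
  define m where "m = moments f"
  define M where "M = n - 2"
  have nM: "n = Suc (Suc M)" using n2 by (simp add: M_def)
  have \<phi>: "\<phi> \<in> carrier_vec n" by (simp add: \<phi>_def Phi2_def)
  have m: "m \<in> carrier_vec n" by (simp add: m_def moments_carrier)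
  have D2\<phi>: "D2 n \<theta> *\<^sub>v \<phi> \<in> carrier_vec (n - 1)" using \<phi> by (meson mult_mat_vec_carrier mat_carriers)
  have D3\<phi>: "D3 n \<theta> *\<^sub>v (D2 n \<theta> *\<^sub>v \<phi>) \<in> carrier_vec (n - 2)"
    using D2\<phi> by (meson mult_mat_vec_carrier mat_carriers)
  define V where "V = (\<lambda>j. \<sigma> (j + 1) * (\<theta> (j + 2) - \<theta> (j + 1))\<^sup>2 / 3)"
  define B where "B = (\<lambda>j. kappa \<theta> (j + 2) * (\<sigma> (j + 2) - \<sigma> (j + 1)))"
  define \<psi> where "\<psi> = (\<lambda>j. (D2 n \<theta> *\<^sub>v \<phi>) $ j)"
  \<comment> \<open>The double end knots make the factors at both ends vanish, which removes the
    boundary terms in the two summations by parts below.\<close>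
  have V0: "V 0 = 0" "V n = 0" by (simp_all add: V_def ends)
  have B0: "B 0 = 0" "B (n - 1) = 0"
  proof -
    have "n - 1 + 2 = Suc n" using nM by simp
    then have "B (n - 1) = kappa \<theta> (Suc n) * (\<sigma> (Suc n) - \<sigma> (n - 1 + 1))" by (simp only: B_def)
    then show "B (n - 1) = 0" by (simp add: kappa_def ends)
    show "B 0 = 0" by (simp add: B_def kappa_def ends)
  qed
  \<comment> \<open>What \<open>S_mat\<close> contributes beyond its diagonal part: a wanted term in
    \<open>V\<close>, and differences of weighted slope jumps that must be cancelled.\<close>
  have off: "alpha n \<theta> (j + 1) * (D2 n \<theta> *\<^sub>v m) $ j =
      - V (Suc j) - 6 / (\<theta> (j + 4) - \<theta> (j + 1)) * (B (Suc j) - B j)" if j: "j < n - 1" for j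
  proof -
    define u v w where "u = \<theta> (j + 2) - \<theta> (j + 1)" and "v = \<theta> (j + 3) - \<theta> (j + 2)"
      and "w = \<theta> (j + 4) - \<theta> (j + 3)"
    have uvw: "0 \<le> u" "0 < v" "0 \<le> w" unfolding u_def v_def w_def
      using j knot_le[of "j + 1" "j + 2"] knot_less[of "j + 2" "j + 3"] knot_le[of "j + 3" "j + 4"] by auto
    have "p (\<theta> (j + 3)) = p (\<theta> (j + 2)) + \<sigma> (j + 2) * v"
      using p[unfolded piecewise_affine_def, rule_format, of "j + 2" "\<theta> (j + 3)"] j uvw
      by (simp add: v_def eval_nat_numeral)
    from two_cell_identity[OF uvw _ _ this, of "m $ j" "\<sigma> (j + 1)" "m $ (j + 1)" "\<sigma> (j + 3)"]
    have entry: "v\<^sup>2 / (u + v + w) * (2 * (m $ j / (u + v) - m $ (j + 1) / (v + w))) =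
      - (\<sigma> (j + 2) * v\<^sup>2 / 3) - 6 / (u + v + w) * (v\<^sup>2 * w\<^sup>2 / (18 * (v + w)) * (\<sigma> (j + 3) - \<sigma> (j + 2))
        - u\<^sup>2 * v\<^sup>2 / (18 * (u + v)) * (\<sigma> (j + 2) - \<sigma> (j + 1)))"
      using mom[of j] mom[of "j + 1"] j
      by (simp add: m_def u_def v_def w_def eval_nat_numeral)
    have widths: "u + v + w = \<theta> (j + 4) - \<theta> (j + 1)" "u + v = \<theta> (j + 3) - \<theta> (j + 1)"
      "v + w = \<theta> (j + 4) - \<theta> (j + 2)"
      by (simp_all add: u_def v_def w_def)
    have kappa: "v\<^sup>2 * w\<^sup>2 / (18 * (\<theta> (j + 4) - \<theta> (j + 2))) = kappa \<theta> (j + 3)"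
      "u\<^sup>2 * v\<^sup>2 / (18 * (\<theta> (j + 3) - \<theta> (j + 1))) = kappa \<theta> (j + 2)"
      by (simp_all add: kappa_def u_def v_def w_def eval_nat_numeral)
    have alpha: "alpha n \<theta> (j + 1) = v\<^sup>2 / (\<theta> (j + 4) - \<theta> (j + 1))"
    proof -
      have "Suc j \<noteq> n" using j by simp
      then show ?thesis by (simp add: alpha_def v_def eval_nat_numeral)
    qed
    have idx: "Suc j + 1 = j + 2" "Suc j + 2 = j + 3" by simp_all
    show ?thesis
      using entry[unfolded widths(1), unfolded widths(2,3) kappa]
      unfolding D2_mult_vec[OF m j] V_def B_def idx alpha v_def[symmetric] .
  qed
  have "(D3 n \<theta> *\<^sub>v (D2 n \<theta> *\<^sub>v m)) \<bullet> (U *\<^sub>v (D3 n \<theta> *\<^sub>v (D2 n \<theta> *\<^sub>v \<phi>))) =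
      (\<Sum>k<M. B (Suc k) * (3 * \<psi> k / (\<theta> (k + 4) - \<theta> (k + 1)) - 3 * \<psi> (Suc k) / (\<theta> (Suc k + 4) - \<theta> (Suc k + 1))))"
    unfolding m_def jumps[OF D3\<phi>] M_def
    by (rule sum.cong) (auto simp: D3_mult_vec[OF D2\<phi>] B_def \<psi>_def eval_nat_numeral right_diff_distrib)
  \<comment> \<open>First summation by parts: the outer difference from \<open>D3\<close> is shifted
    onto the weighted jumps \<open>B\<close>.\<close>
  also have "\<dots> = (\<Sum>j<n - 1. (B (Suc j) - B j) * (3 * \<psi> j / (\<theta> (j + 4) - \<theta> (j + 1))))"
    using B0 by (subst sum_abel) (simp add: nM)
  finally have jumps': "(D3 n \<theta> *\<^sub>v (D2 n \<theta> *\<^sub>v m)) \<bullet> (U *\<^sub>v (D3 n \<theta> *\<^sub>v (D2 n \<theta> *\<^sub>v \<phi>))) =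
      (\<Sum>j<n - 1. (B (Suc j) - B j) * (3 * \<psi> j / (\<theta> (j + 4) - \<theta> (j + 1))))" .
  have "m \<bullet> (S_L n \<theta> U *\<^sub>v \<phi>) = (\<Sum>i<n. 2 / (\<theta> (i + 3) - \<theta> (i + 1)) * m $ i * \<phi> $ i)
    + ((\<Sum>j<n - 1. alpha n \<theta> (j + 1) * (D2 n \<theta> *\<^sub>v m) $ j * \<psi> j) / 2
      + (\<Sum>j<n - 1. (B (Suc j) - B j) * (3 * \<psi> j / (\<theta> (j + 4) - \<theta> (j + 1)))))"
    unfolding kernel_L_form[OF m \<phi> U] S_mat_form[OF m \<phi>] jumps' \<psi>_def by simp
  \<comment> \<open>The \<open>B\<close> terms cancel: half of the factor 6 in \<open>off\<close>
    meets the factor 3 from \<open>D3\<close>.\<close>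
  also have "(\<Sum>j<n - 1. alpha n \<theta> (j + 1) * (D2 n \<theta> *\<^sub>v m) $ j * \<psi> j) / 2
      + (\<Sum>j<n - 1. (B (Suc j) - B j) * (3 * \<psi> j / (\<theta> (j + 4) - \<theta> (j + 1)))) =
      (\<Sum>j<n - 1. - (V (Suc j) * \<psi> j / 2))"
    unfolding sum_divide_distrib sum.distrib[symmetric]
  proof (rule sum.cong)
    fix j assume "j \<in> {..<n - 1}"
    then have j: "j < n - 1" by simp
    show "alpha n \<theta> (j + 1) * (D2 n \<theta> *\<^sub>v m) $ j * \<psi> j / 2
      + (B (Suc j) - B j) * (3 * \<psi> j / (\<theta> (j + 4) - \<theta> (j + 1))) = - (V (Suc j) * \<psi> j / 2)"
    proof -
      have "(- v - 6 / d * e) * y / 2 + e * (3 * y / d) = - (v * y / 2)" for v d e y :: real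
        by (cases "d = 0") (simp_all add: field_simps)
      then show ?thesis unfolding off[OF j] .
    qed
  qed simp
  also have "\<dots> = - (\<Sum>j<n - 1. V (Suc j) * (\<phi> $ j / (\<theta> (j + 3) - \<theta> (j + 1)) - \<phi> $ Suc j / (\<theta> (Suc j + 3) - \<theta> (Suc j + 1))))"
    unfolding sum_negf[symmetric]
    by (rule sum.cong) (auto simp: \<psi>_def D2_mult_vec[OF \<phi>] eval_nat_numeral mult.commute)
  \<comment> \<open>Second summation by parts, now for the difference from
    \<open>D2\<close>.\<close>
  also have "(\<Sum>j<n - 1. V (Suc j) * (\<phi> $ j / (\<theta> (j + 3) - \<theta> (j + 1)) - \<phi> $ Suc j / (\<theta> (Suc j + 3) - \<theta> (Suc j + 1)))) =
      (\<Sum>j<n. (V (Suc j) - V j) * (\<phi> $ j / (\<theta> (j + 3) - \<theta> (j + 1))))"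
    using V0 by (subst sum_abel) (simp add: nM)
  also have "(\<Sum>i<n. 2 / (\<theta> (i + 3) - \<theta> (i + 1)) * m $ i * \<phi> $ i)
      + - (\<Sum>j<n. (V (Suc j) - V j) * (\<phi> $ j / (\<theta> (j + 3) - \<theta> (j + 1)))) =
      (\<Sum>i<n. p (\<theta> (i + 2)) * \<phi> $ i)"
    unfolding sum_negf[symmetric] sum.distrib[symmetric]
  proof (rule sum.cong)
    fix i assume "i \<in> {..<n}"
    then have i: "i < n" by simp
    have "\<theta> (i + 1) < \<theta> (i + 3)" using i by (intro knot_less_skip) auto
    \<comment> \<open>By \<open>mom\<close>, subtracting the \<open>V\<close> difference removes
      exactly the slope terms of the moment and leaves the value at the centre of the hat.\<close>
    moreover have "2 * m $ i - (V (Suc i) - V i) = p (\<theta> (i + 2)) * (\<theta> (i + 3) - \<theta> (i + 1))"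
      using mom[OF i] by (simp add: m_def V_def eval_nat_numeral field_simps)
    ultimately have entry: "(2 * m $ i - (V (Suc i) - V i)) / (\<theta> (i + 3) - \<theta> (i + 1)) = p (\<theta> (i + 2))" by simp
    have "2 / w * y * z + - (v * (z / w)) = (2 * y - v) / w * z" for v w y z :: real
      by (simp add: diff_divide_distrib left_diff_distrib)
    then show "2 / (\<theta> (i + 3) - \<theta> (i + 1)) * m $ i * \<phi> $ i
      + - ((V (Suc i) - V i) * (\<phi> $ i / (\<theta> (i + 3) - \<theta> (i + 1)))) = p (\<theta> (i + 2)) * \<phi> $ i"
      unfolding entry[symmetric] .
  qed simp
  also have "\<dots> = p x"
    using sum_bspline_2[OF p x] by (simp add: \<phi>_def Phi2_def)
  finally show "((\<lambda>y. p y * kernel_L n a b \<theta> U x y) has_integral p x) {a..b}"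
    using has_integral_kernel_L[OF f g U, of x] by (simp add: m_def \<phi>_def)
qed

section \<open>Reproduction of affine functions and of truncated powers\<close>

text \<open>There are no slope jumps, and \<open>D3\<close> applied after \<open>D2\<close>
  annihilates the moments, so both sides of the condition on \<open>U\<close> are 0.\<close>

lemma reproduces_affine:
  assumes U: "U \<in> carrier_mat (n - 2) (n - 2)"
  shows "reproduces a b (kernel_L n a b \<theta> U) (\<lambda>y. c + d * y)"
proof -
  define f where "f = (\<lambda>t :: real. c * t\<^sup>2 / 2 + d * t ^ 3 / 6)"
  have f: "(f has_real_derivative c * t + d * t\<^sup>2 / 2) (at t)" for t
    unfolding f_def by (auto intro!: derivative_eq_intros simp: power2_eq_square field_simps)
  have g: "((\<lambda>t. c * t + d * t\<^sup>2 / 2) has_real_derivative c + d * t) (at t)" for t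
    by (auto intro!: derivative_eq_intros)
  have E: "divdiff \<theta> f i (Suc 0) =
    c * (\<theta> i + \<theta> (Suc i)) / 2 + d * ((\<theta> i)\<^sup>2 + \<theta> i * \<theta> (Suc i) + (\<theta> (Suc i))\<^sup>2) / 6" for i
  proof (cases "\<theta> (Suc i) = \<theta> i")
    case True
    then show ?thesis using DERIV_imp_deriv[OF f, of "\<theta> i"] by (simp add: power2_eq_square)
  next
    case False
    have "f t - f s = (t - s) * (c * (s + t) / 2 + d * (s\<^sup>2 + s * t + t\<^sup>2) / 6)" for s t
      by (simp add: f_def power2_eq_square power3_eq_cube field_simps)
    with False show ?thesis by simp
  qed
  \<comment> \<open>Half the width of the support times the value of the affine function at the mean
    of the three knots.\<close>
  have mom: "moments f $ i = (\<theta> (i + 3) - \<theta> (i + 1)) *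
      (c / 2 + d * (\<theta> (i + 1) + \<theta> (i + 2) + \<theta> (i + 3)) / 6)" if "i < n" for i
    using that by (simp add: moments_def E eval_nat_numeral del: divdiff.simps) (simp add: power2_eq_square field_simps)
  have D2m: "D2 n \<theta> *\<^sub>v moments f \<in> carrier_vec (n - 1)"
    by (meson mult_mat_vec_carrier mat_carriers moments_carrier)
  have D2: "(D2 n \<theta> *\<^sub>v moments f) $ i / (\<theta> (i + 4) - \<theta> (i + 1)) = - (d / 3)" if i: "i < n - 1" for i
  proof -
    have "\<theta> (i + 1) < \<theta> (i + 4)" using i by (auto intro!: knot_less_skip)
    moreover have "\<theta> (i + 1) < \<theta> (i + 3)" "\<theta> (i + 2) < \<theta> (i + 4)" using i by (auto intro!: knot_less_skip)
    moreover from this have "moments f $ i / (\<theta> (i + 3) - \<theta> (i + 1)) =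
        c / 2 + d * (\<theta> (i + 1) + \<theta> (i + 2) + \<theta> (i + 3)) / 6"
      "moments f $ (i + 1) / (\<theta> (i + 4) - \<theta> (i + 2)) =
        c / 2 + d * (\<theta> (i + 2) + \<theta> (i + 3) + \<theta> (i + 4)) / 6"
      using mom[of i] mom[of "i + 1"] i by (simp_all add: eval_nat_numeral)
    ultimately show ?thesis unfolding D2_mult_vec[OF moments_carrier i]
      by (simp only:) (simp add: field_simps)
  qed
  have D3: "D3 n \<theta> *\<^sub>v (D2 n \<theta> *\<^sub>v moments f) = 0\<^sub>v (n - 2)"
  proof (rule eq_vecI)
    fix i assume "i < dim_vec (0\<^sub>v (n - 2) :: real vec)"
    then have i: "i < n - 2" by simp
    show "(D3 n \<theta> *\<^sub>v (D2 n \<theta> *\<^sub>v moments f)) $ i = 0\<^sub>v (n - 2) $ i"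
      unfolding D3_mult_vec[OF D2m i] using D2[of i] D2[of "i + 1"] i
      by (simp add: eval_nat_numeral)
  qed (simp add: D3_def mat1_def)
  show ?thesis
  proof (rule reproduces_piecewise_affine[OF f g U, where \<sigma> = "\<lambda>_. d"])
    show "piecewise_affine (\<lambda>_. d) (\<lambda>y. c + d * y)"
      by (simp add: piecewise_affine_def algebra_simps)
    show "moments f $ i = (c + d * \<theta> (i + 2)) * (\<theta> (i + 3) - \<theta> (i + 1)) / 2
      + (d * (\<theta> (i + 3) - \<theta> (i + 2))\<^sup>2 - d * (\<theta> (i + 2) - \<theta> (i + 1))\<^sup>2) / 6" if "i < n" for i
      unfolding mom[OF that] by (simp add: power2_eq_square field_simps)
    show "(D3 n \<theta> *\<^sub>v (D2 n \<theta> *\<^sub>v moments f)) \<bullet> (U *\<^sub>v v) =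
      (\<Sum>k<n - 2. kappa \<theta> (k + 3) * (d - d) * v $ k)" if "v \<in> carrier_vec (n - 2)" for v
    proof -
      have "U *\<^sub>v v \<in> carrier_vec (n - 2)" using U that by (meson mult_mat_vec_carrier)
      then show ?thesis unfolding D3 by simp
    qed
  qed
qed

text \<open>
  The truncated powers \<open>(x - t)\<^sub>+\<^sup>3\<close> and \<open>(t - x)\<^sub>+\<^sup>3\<close> differ by the cubic \<open>(t - x)\<^sup>3\<close>,
  which fourth-order divided differences annihilate.
\<close>

lemma bspline_raw_4:
  assumes k: "k < n - 2" and f: "f = (\<lambda>t. max 0 (x - t) ^ 3 / 6)"
  shows "(D3 n \<theta> *\<^sub>v (D2 n \<theta> *\<^sub>v moments f)) $ k = bspline_raw \<theta> 4 (k + 1) x"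
proof -
  let ?T = "trunc_pow 3 x"
  have k_le: "Suc (Suc (Suc k)) \<le> n" using k by simp
  have f': "(f has_real_derivative - (max 0 (x - t))\<^sup>2 / 2) (at t)" for t
    using DERIV_cdivide[OF max_pow_has_derivative[of x 1 t], of 6] by (simp add: f eval_nat_numeral)
  have T: "?T = (\<lambda>t. 6 * f t + (t - x) ^ 3)"
    by (auto simp: trunc_pow_def f max_def power3_eq_cube algebra_simps)
  have T': "(?T has_real_derivative 6 * (- (max 0 (x - t))\<^sup>2 / 2) + 3 * (t - x)\<^sup>2) (at t)" for t
    unfolding T by (rule derivative_eq_intros f' refl | simp)+
  \<comment> \<open>Successive divided differences of the cubic are the complete homogeneous
    symmetric polynomials of degrees 2, 1 and 0 in the shifted knots, and then 0; \<open>d1\<close>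
    to \<open>d4\<close> follow this descent.\<close>
  have d1: "divdiff \<theta> ?T i (Suc 0) = 6 * divdiff \<theta> f i (Suc 0)
     + ((\<theta> i - x)\<^sup>2 + (\<theta> i - x) * (\<theta> (Suc i) - x) + (\<theta> (Suc i) - x)\<^sup>2)" for i
  proof (cases "\<theta> (Suc i) = \<theta> i")
    case True
    then show ?thesis using DERIV_imp_deriv[OF f', of "\<theta> i"] DERIV_imp_deriv[OF T', of "\<theta> i"]
      by (simp add: power2_eq_square)
  next
    case False
    have "?T t - ?T s = 6 * (f t - f s) + (t - s) * ((s - x)\<^sup>2 + (s - x) * (t - x) + (t - x)\<^sup>2)" for s t
      by (simp add: T power2_eq_square power3_eq_cube algebra_simps)
    with False show ?thesis by (simp add: add_divide_distrib)
  qed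
  \<comment> \<open>From order 2 on the outer knots differ, so the derivative branch of
    \<open>divdiff\<close> is never taken.\<close>
  have rec: "divdiff \<theta> h i (Suc m) = (divdiff \<theta> h (Suc i) m - divdiff \<theta> h i m) / (\<theta> (i + Suc m) - \<theta> i)"
    and pos: "\<theta> i < \<theta> (i + Suc m)" if "1 \<le> i" "1 \<le> m" "i + m \<le> n + 1" for h i m
    using knot_less_skip[of i "i + Suc m"] that by auto
  have d2: "divdiff \<theta> ?T i 2 = 6 * divdiff \<theta> f i 2 + ((\<theta> i - x) + (\<theta> (i + 1) - x) + (\<theta> (i + 2) - x))"
    if "1 \<le> i" "i \<le> n" for i
    unfolding numeral_2_eq_2 using rec[of i 1 ?T] rec[of i 1 f] pos[of i 1] that
    by (simp add: d1 del: divdiff.simps) (simp add: field_simps power2_eq_square)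
  have d3: "divdiff \<theta> ?T i 3 = 6 * divdiff \<theta> f i 3 + 1" if "1 \<le> i" "i + 1 \<le> n" for i
    using rec[of i 2 ?T] rec[of i 2 f] pos[of i 2] d2[of i] d2[of "Suc i"] that
    by (simp add: eval_nat_numeral del: divdiff.simps) (simp add: field_simps)
  have d4: "divdiff \<theta> ?T i 4 = 6 * divdiff \<theta> f i 4" if "1 \<le> i" "i + 2 \<le> n" for i
    using rec[of i 3 ?T] rec[of i 3 f] pos[of i 3] d3[of i] d3[of "Suc i"] that
    by (simp add: eval_nat_numeral del: divdiff.simps)
  have m: "moments f $ i / (\<theta> (i + 3) - \<theta> (i + 1)) = divdiff \<theta> f (i + 1) 2" if "i < n" for i
    using rec[of "i + 1" 1 f] that by (simp add: moments_def eval_nat_numeral del: divdiff.simps)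
  have D2m: "D2 n \<theta> *\<^sub>v moments f \<in> carrier_vec (n - 1)"
    by (meson mult_mat_vec_carrier mat_carriers moments_carrier)
  \<comment> \<open>The matrices \<open>D2\<close> and \<open>D3\<close> contribute the factors 2
    and 3 and one sign change each; the product 6 compensates the 6 in the denominator of
    \<open>f\<close>.\<close>
  have D2: "(D2 n \<theta> *\<^sub>v moments f) $ i / (\<theta> (i + 4) - \<theta> (i + 1)) = - 2 * divdiff \<theta> f (i + 1) 3"
    if i: "i < n - 1" for i
    unfolding D2_mult_vec[OF moments_carrier i] using m[of i] m[of "i + 1"] i rec[of "i + 1" 2 f]
    by (simp add: eval_nat_numeral del: divdiff.simps)
  have "(D3 n \<theta> *\<^sub>v (D2 n \<theta> *\<^sub>v moments f)) $ k = 6 * (divdiff \<theta> f (k + 2) 3 - divdiff \<theta> f (k + 1) 3)"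
    unfolding D3_mult_vec[OF D2m k] using D2[of k] D2[of "k + 1"] k
    by (simp add: eval_nat_numeral del: divdiff.simps)
  also have "\<dots> = (\<theta> (k + 5) - \<theta> (k + 1)) * divdiff \<theta> ?T (k + 1) 4"
    using k_le d4[of "k + 1"] rec[of "k + 1" 3 f] pos[of "k + 1" 3] k
    by (simp add: eval_nat_numeral del: divdiff.simps)
  also have "\<dots> = bspline_raw \<theta> 4 (k + 1) x"
    by (simp add: bspline_raw_def eval_nat_numeral del: divdiff.simps)
  finally show ?thesis .
qed

text \<open>The hypothesis \<open>sol\<close> is one row of the equation for \<open>U\<close>,
  transposed. That row of the coefficient matrix is the vector that \<open>D2\<close> and
  \<open>D3\<close> make of the moments, and the right-hand side is the single slope jump, which
  sits at the knot \<open>\<theta> l\<close>.\<close>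

lemma reproduces_trunc:
  assumes U: "U \<in> carrier_mat (n - 2) (n - 2)" and l: "3 \<le> l" "l \<le> n"
    and sol: "transpose_mat U *\<^sub>v Matrix.vec (n - 2) (\<lambda>k. bspline a b \<theta> 4 (k + 1) (\<theta> l)) =
      Matrix.vec (n - 2) (\<lambda>k. if k + 1 = l - 2 then kappa \<theta> l else 0)"
  shows "reproduces a b (kernel_L n a b \<theta> U) (\<lambda>y. max 0 (\<theta> l - y))"
proof -
  define f where "f = (\<lambda>t :: real. max 0 (\<theta> l - t) ^ 3 / 6)"
  have f: "(f has_real_derivative - (max 0 (\<theta> l - t))\<^sup>2 / 2) (at t)" for t
    using DERIV_cdivide[OF max_pow_has_derivative[of "\<theta> l" 1 t], of 6] by (simp add: f_def eval_nat_numeral)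
  have g: "((\<lambda>t. - (max 0 (\<theta> l - t))\<^sup>2 / 2) has_real_derivative max 0 (\<theta> l - t)) (at t)" for t
    using DERIV_cdivide[OF max_pow_has_derivative[of "\<theta> l" 0 t], of "- 2"] by (simp add: eval_nat_numeral)
  define u where "u = (\<lambda>i. max 0 (\<theta> l - \<theta> i))"
  have E: "divdiff \<theta> f i (Suc 0) = - ((u i)\<^sup>2 + u i * u (Suc i) + (u (Suc i))\<^sup>2) / 6"
    if i: "1 \<le> i" "i \<le> n + 1" for i
  proof (cases "\<theta> (Suc i) = \<theta> i")
    case True
    then show ?thesis using DERIV_imp_deriv[OF f, of "\<theta> i"] by (simp add: u_def power2_eq_square)
  next
    case False
    have "f (\<theta> (Suc i)) - f (\<theta> i) =
      (u (Suc i) - u i) * ((u i)\<^sup>2 + u i * u (Suc i) + (u (Suc i))\<^sup>2) / 6"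
      by (simp add: f_def u_def power2_eq_square power3_eq_cube algebra_simps diff_divide_distrib add_divide_distrib)
    also have "\<dots> = (\<theta> (Suc i) - \<theta> i) * (- ((u i)\<^sup>2 + u i * u (Suc i) + (u (Suc i))\<^sup>2) / 6)"
    \<comment> \<open>As \<open>\<theta> l\<close> is itself a knot, no knot interval has it in its
      interior: the function is linear with slope -1 or vanishes on each of them.\<close>
    proof (cases "Suc i \<le> l")
      case True
      then have "u i = \<theta> l - \<theta> i" "u (Suc i) = \<theta> l - \<theta> (Suc i)"
        using knot_le[of i l] knot_le[of "Suc i" l] i l by (auto simp: u_def)
      then have "u (Suc i) - u i = - (\<theta> (Suc i) - \<theta> i)" by simp
      then show ?thesis by (simp only:)
    next
      case False
      then have "u i = 0" "u (Suc i) = 0"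
        using knot_le[of l i] knot_le[of l "Suc i"] i l by (auto simp: u_def)
      then show ?thesis by simp
    qed
    finally show ?thesis using False by simp
  qed
  define \<sigma> :: "nat \<Rightarrow> real" where "\<sigma> = (\<lambda>i. if i < l then - 1 else 0)"
  show ?thesis
  proof (rule reproduces_piecewise_affine[OF f g U, where \<sigma> = \<sigma>])
    show "piecewise_affine \<sigma> (\<lambda>y. max 0 (\<theta> l - y))"
      unfolding piecewise_affine_def
    proof (intro ballI)
      fix i y assume i: "i \<in> {2..n}" and y: "y \<in> {\<theta> i..\<theta> (i + 1)}"
      show "max 0 (\<theta> l - y) = max 0 (\<theta> l - \<theta> i) + \<sigma> i * (y - \<theta> i)"
        using knot_le[of "i + 1" l] knot_le[of l i] i y l by (cases "i < l") (auto simp: \<sigma>_def)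
    qed
    show "moments f $ i = max 0 (\<theta> l - \<theta> (i + 2)) * (\<theta> (i + 3) - \<theta> (i + 1)) / 2
      + (\<sigma> (i + 2) * (\<theta> (i + 3) - \<theta> (i + 2))\<^sup>2 - \<sigma> (i + 1) * (\<theta> (i + 2) - \<theta> (i + 1))\<^sup>2) / 6" if i: "i < n" for i
    proof -
      have m: "moments f $ i = ((u (i + 1))\<^sup>2 + u (i + 1) * u (i + 2) - u (i + 2) * u (i + 3) - (u (i + 3))\<^sup>2) / 6"
        using i by (simp add: moments_def E eval_nat_numeral del: divdiff.simps) (simp add: field_simps)
      have nonneg: "u j = \<theta> l - \<theta> j" if "1 \<le> j" "j \<le> l" for j
        using that l knot_le[of j l] by (simp add: u_def)
      have zero: "u j = 0" if "l \<le> j" "j \<le> n + 2" for j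
        using that l knot_le[of l j] by (simp add: u_def)
      \<comment> \<open>The hat centred at \<open>\<theta> (i + 2)\<close> has its support to the
        left of the break, is centred at it, or has its support to the right.\<close>
      consider "i + 3 \<le> l" | "i + 2 = l" | "l \<le> i + 1" by linarith
      then have "moments f $ i = u (i + 2) * (\<theta> (i + 3) - \<theta> (i + 1)) / 2
        + (\<sigma> (i + 2) * (\<theta> (i + 3) - \<theta> (i + 2))\<^sup>2 - \<sigma> (i + 1) * (\<theta> (i + 2) - \<theta> (i + 1))\<^sup>2) / 6"
      proof cases
        case 1
        then have "\<sigma> (i + 1) = - 1" "\<sigma> (i + 2) = - 1" by (auto simp: \<sigma>_def)
        moreover have "u (i + 1) = \<theta> l - \<theta> (i + 1)" "u (i + 2) = \<theta> l - \<theta> (i + 2)"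
          "u (i + 3) = \<theta> l - \<theta> (i + 3)" using 1 by (auto intro!: nonneg)
        ultimately show ?thesis unfolding m by (simp only:) (simp add: power2_eq_square field_simps)
      next
        case 2
        then have "\<sigma> (i + 1) = - 1" "\<sigma> (i + 2) = 0" by (auto simp: \<sigma>_def)
        moreover have "u (i + 1) = \<theta> (i + 2) - \<theta> (i + 1)" "u (i + 2) = 0" "u (i + 3) = 0"
          using 2 i nonneg[of "i + 1"] by (auto intro!: zero)
        ultimately show ?thesis unfolding m by (simp only:) simp
      next
        case 3
        then have "\<sigma> (i + 1) = 0" "\<sigma> (i + 2) = 0" by (auto simp: \<sigma>_def)
        moreover have "u (i + 1) = 0" "u (i + 2) = 0" "u (i + 3) = 0"
          using 3 i by (auto intro!: zero)
        ultimately show ?thesis unfolding m by (simp only:) simp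
      qed
      then show ?thesis by (simp only: u_def)
    qed
    define z where "z = Matrix.vec (n - 2) (\<lambda>k. bspline a b \<theta> 4 (k + 1) (\<theta> l))"
    have z: "z \<in> carrier_vec (n - 2)" by (simp add: z_def)
    \<comment> \<open>At an interior point \<open>bspline\<close> is the raw divided difference,
      without a limit.\<close>
    have "a < \<theta> l" "\<theta> l < b" using knot_less[of 2 l] knot_less[of l "n + 1"] ends l by auto
    have D3: "D3 n \<theta> *\<^sub>v (D2 n \<theta> *\<^sub>v moments f) = z"
    proof (intro eq_vecI)
      show "dim_vec (D3 n \<theta> *\<^sub>v (D2 n \<theta> *\<^sub>v moments f)) = dim_vec z"
        by (simp add: z_def D3_def mat1_def)
      show "(D3 n \<theta> *\<^sub>v (D2 n \<theta> *\<^sub>v moments f)) $ k = z $ k" if "k < dim_vec z" for k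
      proof -
        from that have k: "k < n - 2" by (simp add: z_def)
        show ?thesis unfolding bspline_raw_4[OF k f_def]
          using \<open>a < \<theta> l\<close> \<open>\<theta> l < b\<close> k by (simp add: z_def bspline_def)
      qed
    qed
    show "(D3 n \<theta> *\<^sub>v (D2 n \<theta> *\<^sub>v moments f)) \<bullet> (U *\<^sub>v v) =
      (\<Sum>k<n - 2. kappa \<theta> (k + 3) * (\<sigma> (k + 3) - \<sigma> (k + 2)) * v $ k)" if v: "v \<in> carrier_vec (n - 2)" for v
    proof -
      have "z \<bullet> (U *\<^sub>v v) = (transpose_mat U *\<^sub>v z) \<bullet> v"
        by (rule transpose_vec_mult_scalar[OF U v z, symmetric])
      also have "\<dots> = (\<Sum>k<n - 2. (if k + 1 = l - 2 then kappa \<theta> l else 0) * v $ k)"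
        unfolding z_def sol using v by (simp add: scalar_prod_def atLeast0LessThan)
      \<comment> \<open>The slope jumps only at index \<open>l\<close>, from -1 to 0, so just the
        term \<open>k = l - 3\<close> survives; counted from 1 this is position
        \<open>l - 2\<close>.\<close>
      also have "\<dots> = (\<Sum>k<n - 2. kappa \<theta> (k + 3) * (\<sigma> (k + 3) - \<sigma> (k + 2)) * v $ k)"
      proof (rule sum.cong)
        fix k
        show "(if k + 1 = l - 2 then kappa \<theta> l else 0) * v $ k =
          kappa \<theta> (k + 3) * (\<sigma> (k + 3) - \<sigma> (k + 2)) * v $ k"
          using l by (cases "l = k + 3") (auto simp: \<sigma>_def)
      qed simp
      finally show ?thesis unfolding D3 .
    qed
  qed
qed

end

theorem proposition5p2:
  fixes n r :: nat and a b :: real and \<theta> :: "nat \<Rightarrow> real" and l :: "nat \<Rightarrow> nat"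
    and U :: "real mat"
  assumes "knot_vector n a b \<theta>"
    and "1 \<le> r" and "3 \<le> l 1" and "strict_mono_on {1..r} l" and "l r \<le> n"
    and "U \<in> carrier_mat (n - 2) (n - 2)"
    and "A_mat n a b \<theta> r l * U = B_mat n \<theta> r l"
  shows "(\<forall>p :: real poly. degree p \<le> 1 \<longrightarrow> reproduces a b (kernel_L n a b \<theta> U) (poly p)) \<and>
    (\<forall>j\<in>{1..r}. reproduces a b (kernel_L n a b \<theta> U) (\<lambda>y. max 0 (\<theta> (l j) - y)))"
proof -
  interpret knots n a b \<theta> by unfold_locales fact
  have "reproduces a b (kernel_L n a b \<theta> U) (poly p)" if "degree p \<le> 1" for p :: "real poly"
  proof -
    have "poly p = (\<lambda>y. coeff p 0 + coeff p 1 * y)"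
      using that by (auto simp: poly_altdef le_Suc_eq coeff_eq_0)
    then show ?thesis using reproduces_affine[OF assms(6)] by simp
  qed
  moreover have "reproduces a b (kernel_L n a b \<theta> U) (\<lambda>y. max 0 (\<theta> (l j) - y))" if j: "j \<in> {1..r}" for j
  proof (rule reproduces_trunc[OF assms(6)])
    have "l 1 \<le> l j" "l j \<le> l r"
      using strict_mono_on_leD[OF assms(4)] j assms(2) by auto
    then show "3 \<le> l j" "l j \<le> n" using assms by auto
    let ?z = "Matrix.vec (n - 2) (\<lambda>k. bspline a b \<theta> 4 (k + 1) (\<theta> (l j)))"
    show "transpose_mat U *\<^sub>v ?z = Matrix.vec (n - 2) (\<lambda>k. if k + 1 = l j - 2 then kappa \<theta> (l j) else 0)"
    proof (rule eq_vecI)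
      fix k assume "k < dim_vec (Matrix.vec (n - 2) (\<lambda>k. if k + 1 = l j - 2 then kappa \<theta> (l j) else 0))"
      then have k: "k < n - 2" by simp
      have row: "Matrix.row (A_mat n a b \<theta> r l) (j - 1) = ?z"
        using j by (auto simp: A_mat_def mat1_def)
      \<comment> \<open>Each component is an entry in row \<open>j - 1\<close>, counted from 0, of
        the matrix equation.\<close>
      have "(transpose_mat U *\<^sub>v ?z) $ k = Matrix.col U k \<bullet> ?z"
        using k assms(6) by simp
      also have "\<dots> = ?z \<bullet> Matrix.col U k"
        using k assms(6) by (intro comm_scalar_prod[of _ "n - 2"]) auto
      also have "\<dots> = (A_mat n a b \<theta> r l * U) $$ (j - 1, k)"
        using k j assms(6) by (subst index_mult_mat) (auto simp: row A_mat_def mat1_def simp flip: row)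
      also have "\<dots> = (if k + 1 = l j - 2 then kappa \<theta> (l j) else 0)"
        proof -
        have "j - 1 < r" "j - 1 + 1 = j" using j by auto
        then show ?thesis unfolding assms(7) using k by (simp add: B_mat_def mat1_def)
      qed
      finally show "(transpose_mat U *\<^sub>v ?z) $ k =
        Matrix.vec (n - 2) (\<lambda>k. if k + 1 = l j - 2 then kappa \<theta> (l j) else 0) $ k"
        using k by simp
    qed (use assms(6) in simp)
  qed
  ultimately show ?thesis by blast
qed

end
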